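(* Let $Y$ be a real topological vector space, $D\subset Y$ a non-trivial closed convex cone with $\operatorname{int}D\neq\emptyset$, and $F\subseteq Y$. If $F\subseteq a-\operatorname{int}D$ or $F\subseteq a+\operatorname{int}D$ for some $a\in Y$, then $$\operatorname{WEff}(F,D)=\{y^0\in F\mid\exists k\in\operatorname{int}D:\ \varphi_{a-D,k}(y^0)=\min_{y\in F}\varphi_{a-D,k}(y)\}$$ and $$\operatorname{Eff}(F,D)=\{y^0\in F\mid\exists k\in\operatorname{int}D\ \forall y\in F\setminus\{y^0\}:\ \varphi_{a-D,k}(y^0)<\varphi_{a-D,k}(y)\}.$$ For $y^0\in\operatorname{WEff}(F,D)$, in the case $F\subseteq a-\operatorname{int}D$ one can choose $k=a-y^0$, which results in $\varphi_{a-D,k}(y^0)=-1$, whereas in the case $F\subseteq a+\operatorname{int}D$ one can choose $k=y^0-a$, which results in $\varphi_{a-D,k}(y^0)=1$.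
   Context: $\operatorname{Eff}(F,D):=\{y^0\in F\mid F\cap(y^0-D)\subseteq\{y^0\}\}$ and $\operatorname{WEff}(F,D):=\operatorname{Eff}(F,\operatorname{int}D)$. A set $C\subseteq Y$ is a cone if $\mathbb{R}_+C\subseteq C$ with $\mathbb{R}_+=\{x\in\mathbb{R}\mid x\ge0\}$; it is non-trivial if $C\neq\emptyset$, $C\neq\{0\}$, $C\neq Y$. For $a\in Y$ and $k\in\operatorname{int}D$, $\varphi_{a-D,k}(y):=\inf\{t\in\mathbb{R}\mid y\in a-D+tk\}$ for $y\in Y$ (this functional is finite-valued on $Y$). *)

theory Defs
  imports "HOL-Analysis.Analysis"
begin

text \<open>
  Real topological vector spaces, not assumed to be Hausdorff. Joint continuity of addition and
  continuity of negation come from \<^class>\<open>topological_ab_group_add\<close>; the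
  axiom below is joint continuity of scalar multiplication, in the style of that class.
\<close>

class real_topological_vector = real_vector + topological_ab_group_add +
  assumes tendsto_scaleR_Pair:
    "LIM p (nhds c \<times>\<^sub>F nhds x). fst p *\<^sub>R snd p :> nhds (c *\<^sub>R x)"

instance real_normed_vector \<subseteq> real_topological_vector
proof
  fix c :: real and x :: 'a
  show "LIM p (nhds c \<times>\<^sub>F nhds x). fst p *\<^sub>R snd p :> nhds (c *\<^sub>R x)"
    by (intro tendsto_scaleR filterlim_fst filterlim_snd)
qed

definition nontrivial_cone :: "'a::real_vector set \<Rightarrow> bool" where
  "nontrivial_cone C \<longleftrightarrow> cone C \<and> C \<noteq> {} \<and> C \<noteq> {0} \<and> C \<noteq> UNIV"

definition Eff :: "'a::ab_group_add set \<Rightarrow> 'a set \<Rightarrow> 'a set" where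
  "Eff F D = {y0 \<in> F. F \<inter> (\<lambda>d. y0 - d) ` D \<subseteq> {y0}}"

definition WEff :: "'a::real_topological_vector set \<Rightarrow> 'a set \<Rightarrow> 'a set" where
  "WEff F D = Eff F (interior D)"

text \<open>
  The infimum is taken in \<^typ>\<open>real\<close>, where it is meaningful only if the set is
  non-empty and bounded below. This is the case for \<open>A = (\<lambda>d. a - d) ` D\<close> with \<open>D\<close> a
  non-trivial closed convex cone and \<open>k \<in> interior D\<close>.
\<close>

definition phi :: "'a::real_vector set \<Rightarrow> 'a \<Rightarrow> 'a \<Rightarrow> real" where
  "phi A k y = Inf {t. y \<in> (\<lambda>x. x + t *\<^sub>R k) ` A}"

end

theory Submission
  imports Defs
begin

text \<open>
  Write \<open>\<phi>\<close> for \<open>phi ((\<lambda>d. a - d) ` D) k\<close> with \<open>k \<in> interior D\<close>. Everything follows from the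
  description of the sublevel sets of \<open>\<phi>\<close> (lemmas \<open>phi_le_iff\<close> and \<open>phi_less_iff\<close>):
  \<open>\<phi> y \<le> t\<close> iff \<open>a - y + t k \<in> D\<close>, and \<open>\<phi> y < t\<close> iff \<open>a - y + t k \<in> interior D\<close>.

  Since \<open>D + D \<subseteq> D\<close> and \<open>D + interior D \<subseteq> interior D\<close>, these descriptions make \<open>\<phi>\<close> monotone
  for \<open>D\<close> and strictly monotone for \<open>interior D\<close>. Hence minimizers over \<open>F\<close> are weakly efficient
  and strict minimizers are efficient.

  Conversely, the sublevel set of \<open>\<phi>\<close> at height \<open>t\<close> is the translate \<open>a + t k - D\<close>. If its apex
  \<open>a + t k\<close> is a weakly efficient point \<open>y0\<close>, then no point of \<open>F\<close> lies in its interior, which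
  says that \<open>\<phi> y0 = t\<close> is minimal over \<open>F\<close>; if \<open>y0\<close> is efficient, then no other point of \<open>F\<close>
  lies in the sublevel set at all, and the minimum is strict (lemma \<open>phi_minimal_at_apex\<close>). The
  assumption on \<open>F\<close> provides such a representation of \<open>y0\<close>: with \<open>k = a - y0\<close> and \<open>t = -1\<close> if
  \<open>F\<close> lies below \<open>a\<close>, and with \<open>k = y0 - a\<close> and \<open>t = 1\<close> if \<open>F\<close> lies above \<open>a\<close>.
\<close>

section \<open>Interior of a convex cone in a topological vector space\<close>

lemma tendsto_scaleR_tvs:
  fixes g :: "'b \<Rightarrow> 'a::real_topological_vector"
  assumes "(f \<longlongrightarrow> c) G" and "(g \<longlongrightarrow> x) G"
  shows "((\<lambda>i. f i *\<^sub>R g i) \<longlongrightarrow> c *\<^sub>R x) G"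
  using filterlim_compose[OF tendsto_scaleR_Pair filterlim_Pair[OF assms]] by simp

lemma continuous_on_line:
  fixes v k :: "'a::real_topological_vector"
  shows "continuous_on UNIV (\<lambda>t. v + t *\<^sub>R k)"
  unfolding continuous_on_def by (intro ballI tendsto_add tendsto_scaleR_tvs tendsto_intros)

lemma tendsto_scaled_perturbation:
  fixes v w :: "'a::real_topological_vector"
  shows "((\<lambda>t. w + inverse t *\<^sub>R v) \<longlongrightarrow> w) at_top"
proof -
  have "((\<lambda>t. w + inverse t *\<^sub>R v) \<longlongrightarrow> w + 0 *\<^sub>R v) at_top"
    by (intro tendsto_add tendsto_scaleR_tvs tendsto_const tendsto_inverse_0_at_top filterlim_ident)
  then show ?thesis by simp
qed

text \<open>
  The translate of \<open>interior D\<close> by \<open>x\<close> is open, and it lies in \<open>D\<close>.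
\<close>

lemma add_interior_mem:
  fixes D :: "'a::real_topological_vector set"
  assumes add: "\<And>x y. x \<in> D \<Longrightarrow> y \<in> D \<Longrightarrow> x + y \<in> D"
    and "x \<in> D" and "y \<in> interior D"
  shows "x + y \<in> interior D"
proof (rule interiorI)
  have "continuous_on UNIV (\<lambda>z::'a. z - x)"
    unfolding continuous_on_def by (intro ballI tendsto_diff tendsto_intros)
  then show "open ((\<lambda>z. z - x) -` interior D)"
    by (rule open_vimage[OF open_interior])
  show "x + y \<in> (\<lambda>z. z - x) -` interior D"
    using assms(3) by simp
  show "(\<lambda>z. z - x) -` interior D \<subseteq> D"
  proof
    fix z assume "z \<in> (\<lambda>z. z - x) -` interior D"
    then have "z - x \<in> D" using interior_subset by auto
    from add[OF \<open>x \<in> D\<close> this] show "z \<in> D" by simp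
  qed
qed

text \<open>
  An interior point \<open>w\<close> absorbs every direction \<open>v\<close>: the points \<open>w + v / t\<close> tend to \<open>w\<close>, and
  multiplying by \<open>t\<close> does not leave the cone.
\<close>

lemma cone_absorbs_direction:
  fixes D :: "'a::real_topological_vector set"
  assumes "cone D" and "w \<in> interior D"
  shows "\<exists>t>0. v + t *\<^sub>R w \<in> D"
proof -
  have "\<forall>\<^sub>F t in at_top. w + inverse t *\<^sub>R v \<in> interior D"
    using tendsto_scaled_perturbation open_interior assms(2) by (rule topological_tendstoD)
  moreover have "\<forall>\<^sub>F t::real in at_top. t > 0"
    by (rule eventually_gt_at_top)
  ultimately have "\<forall>\<^sub>F t in at_top. w + inverse t *\<^sub>R v \<in> interior D \<and> t > 0"
    by (rule eventually_conj)
  then obtain t where t: "w + inverse t *\<^sub>R v \<in> interior D" "t > 0"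
    by (auto dest!: eventually_happens)
  then have "t *\<^sub>R (w + inverse t *\<^sub>R v) \<in> D"
    using assms(1) interior_subset by (metis less_imp_le mem_cone subsetD)
  then have "v + t *\<^sub>R w \<in> D"
    using t(2) by (simp add: scaleR_add_right add.commute)
  then show ?thesis using t(2) by blast
qed

lemma scaleR_interior_cone:
  fixes D :: "'a::real_topological_vector set"
  assumes "cone D" and "x \<in> interior D" and "r > 0"
  shows "r *\<^sub>R x \<in> interior D"
proof (rule interiorI)
  have "continuous_on UNIV (\<lambda>z::'a. inverse r *\<^sub>R z)"
    unfolding continuous_on_def by (intro ballI tendsto_scaleR_tvs tendsto_intros)
  then show "open ((\<lambda>z. inverse r *\<^sub>R z) -` interior D)"
    by (rule open_vimage[OF open_interior])
  show "r *\<^sub>R x \<in> (\<lambda>z. inverse r *\<^sub>R z) -` interior D"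
    using assms(2,3) by simp
  show "(\<lambda>z. inverse r *\<^sub>R z) -` interior D \<subseteq> D"
  proof
    fix z assume "z \<in> (\<lambda>z. inverse r *\<^sub>R z) -` interior D"
    then have "inverse r *\<^sub>R z \<in> D" using interior_subset by auto
    then have "r *\<^sub>R inverse r *\<^sub>R z \<in> D"
      by (rule mem_cone[OF assms(1) _ less_imp_le[OF assms(3)]])
    then show "z \<in> D" using assms(3) by simp
  qed
qed

lemma zero_notin_interior_cone:
  fixes D :: "'a::real_topological_vector set"
  assumes "cone D" and "D \<noteq> UNIV"
  shows "0 \<notin> interior D"
proof
  assume 0: "0 \<in> interior D"
  have "v \<in> D" for v
    using cone_absorbs_direction[OF assms(1) 0, of v] by simp
  then show False using assms(2) by blast
qed

section \<open>Efficiency in terms of differences\<close>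

lemma mem_translate_uminus_iff:
  fixes x y :: "'a::ab_group_add"
  shows "y \<in> (\<lambda>d. x - d) ` S \<longleftrightarrow> x - y \<in> S"
proof
  assume "x - y \<in> S"
  then have "x - (x - y) \<in> (\<lambda>d. x - d) ` S" by (rule imageI)
  then show "y \<in> (\<lambda>d. x - d) ` S" by simp
qed auto

lemma mem_Eff_iff:
  fixes D :: "'a::ab_group_add set"
  shows "y0 \<in> Eff F D \<longleftrightarrow> y0 \<in> F \<and> (\<forall>y\<in>F - {y0}. y0 - y \<notin> D)"
proof -
  have "y \<in> (\<lambda>d. y0 - d) ` D \<longleftrightarrow> y0 - y \<in> D" for y
    by (rule mem_translate_uminus_iff)
  then show ?thesis unfolding Eff_def by blast
qed

section \<open>Sublevel sets of the functional\<close>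

text \<open>
  For a cone, convexity amounts to closure under addition, the form needed below.
\<close>

locale proper_closed_convex_cone =
  fixes D :: "'a::real_topological_vector set"
  assumes cone: "cone D"
    and proper: "D \<noteq> UNIV"
    and closed: "closed D"
    and add: "x \<in> D \<Longrightarrow> y \<in> D \<Longrightarrow> x + y \<in> D"
begin

lemma line_upward_closed:
  assumes "k \<in> D" and "v + s *\<^sub>R k \<in> D" and "s \<le> t"
  shows "v + t *\<^sub>R k \<in> D"
proof -
  have "(t - s) *\<^sub>R k \<in> D" using assms cone by (simp add: mem_cone)
  from add[OF assms(2) this] show ?thesis by (simp add: algebra_simps)
qed

text \<open>
  If a whole backward ray stayed in \<open>D\<close>, rescaling it would give \<open>-k\<close> as a limit of points of
  \<open>D\<close>; but then \<open>-k + k = 0\<close> would be an interior point.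
\<close>

lemma line_leaves_cone:
  assumes k: "k \<in> interior D"
  shows "\<exists>s. v + s *\<^sub>R k \<notin> D"
proof (rule ccontr)
  assume "\<nexists>s. v + s *\<^sub>R k \<notin> D"
  then have all: "v + s *\<^sub>R k \<in> D" for s by blast
  have "- k + inverse t *\<^sub>R v \<in> D" if "t > 0" for t
  proof -
    have "inverse t *\<^sub>R (v + (- t) *\<^sub>R k) \<in> D"
      using all[of "- t"] cone that by (intro mem_cone) auto
    then show ?thesis using that by (simp add: scaleR_diff_right)
  qed
  then have "\<forall>\<^sub>F t in at_top. - k + inverse t *\<^sub>R v \<in> D"
    using eventually_gt_at_top[of "0::real"] by (rule eventually_mono[rotated])
  then have "- k \<in> D"
    using Lim_in_closed_set[OF closed _ _ tendsto_scaled_perturbation] by simp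
  then have "- k + k \<in> interior D"
    using add_interior_mem[of D] add k by blast
  then show False using zero_notin_interior_cone[OF cone proper] by simp
qed

lemma bdd_below_line_parameters:
  assumes "k \<in> interior D"
  shows "bdd_below {t. v + t *\<^sub>R k \<in> D}"
proof -
  have "k \<in> D" using assms interior_subset by blast
  obtain s where "v + s *\<^sub>R k \<notin> D" using line_leaves_cone[OF assms] by blast
  then have "s \<le> t" if "v + t *\<^sub>R k \<in> D" for t
    using line_upward_closed[OF \<open>k \<in> D\<close> that] by (meson linear)
  then show ?thesis by (intro bdd_belowI[of _ s]) auto
qed

lemma phi_cone_eq: "phi ((\<lambda>d. a - d) ` D) k y = Inf {t. (a - y) + t *\<^sub>R k \<in> D}"
proof -
  have "y \<in> (\<lambda>x. x + t *\<^sub>R k) ` (\<lambda>d. a - d) ` D \<longleftrightarrow> (a - y) + t *\<^sub>R k \<in> D" for t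
  proof
    assume "y \<in> (\<lambda>x. x + t *\<^sub>R k) ` (\<lambda>d. a - d) ` D"
    then obtain d where "d \<in> D" "y = a - d + t *\<^sub>R k" by blast
    then show "(a - y) + t *\<^sub>R k \<in> D" by simp
  next
    assume "(a - y) + t *\<^sub>R k \<in> D"
    moreover have "y = a - ((a - y) + t *\<^sub>R k) + t *\<^sub>R k" by simp
    ultimately show "y \<in> (\<lambda>x. x + t *\<^sub>R k) ` (\<lambda>d. a - d) ` D" by blast
  qed
  then show ?thesis by (simp add: phi_def)
qed

text \<open>
  Closedness of \<open>D\<close> makes the infimum a minimum, and the parameter set is upward closed.
\<close>

lemma phi_le_iff:
  assumes k: "k \<in> interior D"
  shows "phi ((\<lambda>d. a - d) ` D) k y \<le> t \<longleftrightarrow> (a - y) + t *\<^sub>R k \<in> D"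
proof -
  let ?T = "{t. (a - y) + t *\<^sub>R k \<in> D}"
  have "closed ((\<lambda>t. (a - y) + t *\<^sub>R k) -` D)"
    by (rule closed_vimage[OF closed continuous_on_line])
  then have "closed ?T" by (simp add: vimage_def)
  moreover have "?T \<noteq> {}" using cone_absorbs_direction[OF cone k] by auto
  moreover have bdd: "bdd_below ?T" by (rule bdd_below_line_parameters[OF k])
  ultimately have "Inf ?T \<in> ?T" by (intro closed_contains_Inf)
  then have "(a - y) + t *\<^sub>R k \<in> D" if "Inf ?T \<le> t"
    using line_upward_closed[OF _ _ that] k interior_subset by blast
  moreover have "Inf ?T \<le> t" if "(a - y) + t *\<^sub>R k \<in> D"
    using that by (intro cInf_lower bdd) simp
  ultimately show ?thesis unfolding phi_cone_eq by blast
qed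

text \<open>
  Moving up from the attained value adds a positive multiple of the interior point \<open>k\<close>, which
  leads into the interior; conversely, an interior point of the line leaves room to move down.
\<close>

lemma phi_less_iff:
  assumes k: "k \<in> interior D"
  shows "phi ((\<lambda>d. a - d) ` D) k y < t \<longleftrightarrow> (a - y) + t *\<^sub>R k \<in> interior D"
proof
  assume less: "phi ((\<lambda>d. a - d) ` D) k y < t"
  let ?p = "phi ((\<lambda>d. a - d) ` D) k y"
  have "(a - y) + ?p *\<^sub>R k \<in> D"
    using phi_le_iff[OF k, of a y ?p] by simp
  moreover have "(t - ?p) *\<^sub>R k \<in> interior D"
    using less by (intro scaleR_interior_cone cone k) simp
  ultimately have "((a - y) + ?p *\<^sub>R k) + (t - ?p) *\<^sub>R k \<in> interior D"
    by (intro add_interior_mem[OF add])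
  then show "(a - y) + t *\<^sub>R k \<in> interior D" by (simp add: algebra_simps)
next
  assume "(a - y) + t *\<^sub>R k \<in> interior D"
  then have "t \<in> (\<lambda>t. (a - y) + t *\<^sub>R k) -` interior D" by simp
  moreover have "open ((\<lambda>t. (a - y) + t *\<^sub>R k) -` interior D)"
    by (rule open_vimage[OF open_interior continuous_on_line])
  ultimately obtain e where "e > 0"
    and e: "ball t e \<subseteq> (\<lambda>t. (a - y) + t *\<^sub>R k) -` interior D"
    by (metis openE)
  have "t - e / 2 \<in> ball t e" using \<open>e > 0\<close> by (simp add: dist_real_def)
  then have "(a - y) + (t - e / 2) *\<^sub>R k \<in> D" using e interior_subset by blast
  then have "phi ((\<lambda>d. a - d) ` D) k y \<le> t - e / 2" by (simp only: phi_le_iff[OF k])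
  then show "phi ((\<lambda>d. a - d) ` D) k y < t" using \<open>e > 0\<close> by simp
qed

section \<open>Efficient points as minimizers\<close>

text \<open>
  Since \<open>0\<close> is not interior to \<open>D\<close>, \<open>y0 - y \<in> interior D\<close> already forces \<open>y \<noteq> y0\<close>.
\<close>

lemma mem_WEff_iff: "y0 \<in> WEff F D \<longleftrightarrow> y0 \<in> F \<and> (\<forall>y\<in>F. y0 - y \<notin> interior D)"
proof -
  have "y \<in> (\<lambda>d. y0 - d) ` interior D \<longleftrightarrow> y0 - y \<in> interior D" for y
    by (rule mem_translate_uminus_iff)
  moreover have "y0 - y0 \<notin> interior D" using zero_notin_interior_cone[OF cone proper] by simp
  ultimately show ?thesis unfolding WEff_def Eff_def by blast
qed

lemma Eff_subset_WEff: "Eff F D \<subseteq> WEff F D"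
proof -
  have "y0 - y0 \<notin> interior D" for y0 using zero_notin_interior_cone[OF cone proper] by simp
  then show ?thesis unfolding mem_Eff_iff mem_WEff_iff subset_iff
    using interior_subset by blast
qed

lemma phi_mono:
  assumes k: "k \<in> interior D" and "y0 - y \<in> D"
  shows "phi ((\<lambda>d. a - d) ` D) k y \<le> phi ((\<lambda>d. a - d) ` D) k y0"
proof -
  let ?p = "phi ((\<lambda>d. a - d) ` D) k y0"
  have "(a - y0) + ?p *\<^sub>R k \<in> D" using phi_le_iff[OF k, of a y0 ?p] by simp
  from add[OF assms(2) this] have "(a - y) + ?p *\<^sub>R k \<in> D" by (simp add: algebra_simps)
  then show ?thesis by (simp only: phi_le_iff[OF k])
qed

lemma phi_strict_mono:
  assumes k: "k \<in> interior D" and "y0 - y \<in> interior D"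
  shows "phi ((\<lambda>d. a - d) ` D) k y < phi ((\<lambda>d. a - d) ` D) k y0"
proof -
  let ?p = "phi ((\<lambda>d. a - d) ` D) k y0"
  have "(a - y0) + ?p *\<^sub>R k \<in> D" using phi_le_iff[OF k, of a y0 ?p] by simp
  with assms(2) have "((a - y0) + ?p *\<^sub>R k) + (y0 - y) \<in> interior D"
    by (intro add_interior_mem[OF add])
  then have "(a - y) + ?p *\<^sub>R k \<in> interior D" by (simp add: algebra_simps)
  then show ?thesis by (simp only: phi_less_iff[OF k])
qed

lemma minimizer_in_WEff:
  assumes "k \<in> interior D" and "y0 \<in> F"
    and "\<forall>y\<in>F. phi ((\<lambda>d. a - d) ` D) k y0 \<le> phi ((\<lambda>d. a - d) ` D) k y"
  shows "y0 \<in> WEff F D"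
  unfolding mem_WEff_iff using assms phi_strict_mono by (meson not_le)

lemma strict_minimizer_in_Eff:
  assumes "k \<in> interior D" and "y0 \<in> F"
    and "\<forall>y\<in>F - {y0}. phi ((\<lambda>d. a - d) ` D) k y0 < phi ((\<lambda>d. a - d) ` D) k y"
  shows "y0 \<in> Eff F D"
  unfolding mem_Eff_iff using assms phi_mono by (meson not_le)

text \<open>
  If \<open>y0 = a + t k\<close>, then \<open>a - y + t k = y0 - y\<close>: the sublevel set at height \<open>t\<close> is
  \<open>y0 - D\<close>, the very set that the definition of efficiency compares with \<open>F\<close>.
\<close>

lemma phi_minimal_at_apex:
  assumes k: "k \<in> interior D" and apex: "y0 = a + t *\<^sub>R k" and weff: "y0 \<in> WEff F D"
  shows "phi ((\<lambda>d. a - d) ` D) k y0 = t"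
    and "\<forall>y\<in>F. phi ((\<lambda>d. a - d) ` D) k y0 \<le> phi ((\<lambda>d. a - d) ` D) k y"
    and "y0 \<in> Eff F D \<Longrightarrow>
      \<forall>y\<in>F - {y0}. phi ((\<lambda>d. a - d) ` D) k y0 < phi ((\<lambda>d. a - d) ` D) k y"
proof -
  have diff: "(a - y) + t *\<^sub>R k = y0 - y" for y by (simp add: apex)
  have le: "phi ((\<lambda>d. a - d) ` D) k y \<le> t \<longleftrightarrow> y0 - y \<in> D" for y
    by (simp only: phi_le_iff[OF k] diff)
  have less: "phi ((\<lambda>d. a - d) ` D) k y < t \<longleftrightarrow> y0 - y \<in> interior D" for y
    by (simp only: phi_less_iff[OF k] diff)
  have lower: "\<forall>y\<in>F. t \<le> phi ((\<lambda>d. a - d) ` D) k y"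
    using weff less unfolding mem_WEff_iff by (meson not_le)
  have "0 *\<^sub>R k \<in> D" using cone k interior_subset by (intro mem_cone) auto
  then have "phi ((\<lambda>d. a - d) ` D) k y0 \<le> t" using le by simp
  moreover have "y0 \<in> F" using weff by (simp add: mem_WEff_iff)
  ultimately show phi_apex: "phi ((\<lambda>d. a - d) ` D) k y0 = t" using lower by force
  show "\<forall>y\<in>F. phi ((\<lambda>d. a - d) ` D) k y0 \<le> phi ((\<lambda>d. a - d) ` D) k y"
    using lower phi_apex by simp
  show "\<forall>y\<in>F - {y0}. phi ((\<lambda>d. a - d) ` D) k y0 < phi ((\<lambda>d. a - d) ` D) k y"
    if "y0 \<in> Eff F D"
    using that le phi_apex unfolding mem_Eff_iff by (meson not_le)
qed

end

theorem theorem8: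
  fixes D F :: "'a::real_topological_vector set" and a :: 'a
  assumes "nontrivial_cone D" and "closed D" and "convex D" and "interior D \<noteq> {}"
    and "F \<subseteq> (\<lambda>d. a - d) ` interior D \<or> F \<subseteq> (\<lambda>d. a + d) ` interior D"
  shows "(WEff F D =
      {y0 \<in> F. \<exists>k\<in>interior D. \<forall>y\<in>F. phi ((\<lambda>d. a - d) ` D) k y0 \<le> phi ((\<lambda>d. a - d) ` D) k y}) \<and>
    (Eff F D =
      {y0 \<in> F. \<exists>k\<in>interior D. \<forall>y\<in>F - {y0}. phi ((\<lambda>d. a - d) ` D) k y0 < phi ((\<lambda>d. a - d) ` D) k y}) \<and>
    (\<forall>y0\<in>WEff F D. F \<subseteq> (\<lambda>d. a - d) ` interior D \<longrightarrow>
      (let k = a - y0 in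
        k \<in> interior D \<and> phi ((\<lambda>d. a - d) ` D) k y0 = -1 \<and>
        (\<forall>y\<in>F. phi ((\<lambda>d. a - d) ` D) k y0 \<le> phi ((\<lambda>d. a - d) ` D) k y) \<and>
        (y0 \<in> Eff F D \<longrightarrow> (\<forall>y\<in>F - {y0}. phi ((\<lambda>d. a - d) ` D) k y0 < phi ((\<lambda>d. a - d) ` D) k y)))) \<and>
    (\<forall>y0\<in>WEff F D. F \<subseteq> (\<lambda>d. a + d) ` interior D \<longrightarrow>
      (let k = y0 - a in
        k \<in> interior D \<and> phi ((\<lambda>d. a - d) ` D) k y0 = 1 \<and>
        (\<forall>y\<in>F. phi ((\<lambda>d. a - d) ` D) k y0 \<le> phi ((\<lambda>d. a - d) ` D) k y) \<and>
        (y0 \<in> Eff F D \<longrightarrow> (\<forall>y\<in>F - {y0}. phi ((\<lambda>d. a - d) ` D) k y0 < phi ((\<lambda>d. a - d) ` D) k y))))"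
proof -
  interpret proper_closed_convex_cone D
    using assms(1-3) convex_cone[of D] by unfold_locales (auto simp: nontrivial_cone_def)
  let ?\<phi> = "phi ((\<lambda>d. a - d) ` D)"
  have below: "a - y0 \<in> interior D" "y0 = a + (- 1) *\<^sub>R (a - y0)"
    if "F \<subseteq> (\<lambda>d. a - d) ` interior D" "y0 \<in> F" for y0
    using that by auto
  have above: "y0 - a \<in> interior D" "y0 = a + 1 *\<^sub>R (y0 - a)"
    if "F \<subseteq> (\<lambda>d. a + d) ` interior D" "y0 \<in> F" for y0
    using that by auto
  have WEff_F: "y0 \<in> F" if "y0 \<in> WEff F D" for y0 using that by (simp add: mem_WEff_iff)
  have apex: "\<exists>k\<in>interior D. \<exists>t. y0 = a + t *\<^sub>R k" if "y0 \<in> F" for y0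
    using assms(5) below[OF _ that] above[OF _ that] by blast
  have "WEff F D = {y0 \<in> F. \<exists>k\<in>interior D. \<forall>y\<in>F. ?\<phi> k y0 \<le> ?\<phi> k y}"
  proof (intro set_eqI iffI)
    fix y0 assume y0: "y0 \<in> WEff F D"
    then obtain k t where "k \<in> interior D" "y0 = a + t *\<^sub>R k" using apex WEff_F by blast
    with phi_minimal_at_apex(2)[OF this y0] WEff_F[OF y0]
    show "y0 \<in> {y0 \<in> F. \<exists>k\<in>interior D. \<forall>y\<in>F. ?\<phi> k y0 \<le> ?\<phi> k y}" by blast
  qed (use minimizer_in_WEff in blast)
  moreover have "Eff F D = {y0 \<in> F. \<exists>k\<in>interior D. \<forall>y\<in>F - {y0}. ?\<phi> k y0 < ?\<phi> k y}"
  proof (intro set_eqI iffI)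
    fix y0 assume y0: "y0 \<in> Eff F D"
    then have weff: "y0 \<in> WEff F D" using Eff_subset_WEff by blast
    then obtain k t where "k \<in> interior D" "y0 = a + t *\<^sub>R k" using apex WEff_F by blast
    with phi_minimal_at_apex(3)[OF this weff y0] WEff_F[OF weff]
    show "y0 \<in> {y0 \<in> F. \<exists>k\<in>interior D. \<forall>y\<in>F - {y0}. ?\<phi> k y0 < ?\<phi> k y}" by blast
  qed (use strict_minimizer_in_Eff in blast)
  ultimately show ?thesis
    unfolding Let_def
  proof (intro conjI ballI impI)
    fix y0 assume weff: "y0 \<in> WEff F D" and F: "F \<subseteq> (\<lambda>d. a - d) ` interior D"
    note apex_y0 = below[OF F WEff_F[OF weff]]
    note minimal = phi_minimal_at_apex[OF apex_y0 weff]
    show "a - y0 \<in> interior D" by (rule apex_y0(1))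
    show "?\<phi> (a - y0) y0 = - 1" by (rule minimal(1))
    show "?\<phi> (a - y0) y0 \<le> ?\<phi> (a - y0) y" if "y \<in> F" for y
      using minimal(2) that by blast
    show "?\<phi> (a - y0) y0 < ?\<phi> (a - y0) y" if "y0 \<in> Eff F D" "y \<in> F - {y0}" for y
      using minimal(3) that by blast
  next
    fix y0 assume weff: "y0 \<in> WEff F D" and F: "F \<subseteq> (\<lambda>d. a + d) ` interior D"
    note apex_y0 = above[OF F WEff_F[OF weff]]
    note minimal = phi_minimal_at_apex[OF apex_y0 weff]
    show "y0 - a \<in> interior D" by (rule apex_y0(1))
    show "?\<phi> (y0 - a) y0 = 1" by (rule minimal(1))
    show "?\<phi> (y0 - a) y0 \<le> ?\<phi> (y0 - a) y" if "y \<in> F" for y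
      using minimal(2) that by blast
    show "?\<phi> (y0 - a) y0 < ?\<phi> (y0 - a) y" if "y0 \<in> Eff F D" "y \<in> F - {y0}" for y
      using minimal(3) that by blast
  qed
qed

end
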